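(* Let $p,q,r$ be fixed positive integers with $p\geq q\geq r$ and $\gcd(p,q,r)=1$, and let $\mathcal{L}$ denote the equation $px+qy=rz$. Let $t:=\gcd(p,q)$, $r_1:=p/t$ and $r_2:=q/t$. For $n\in\mathbb{N}$ let $\mu_{\mathcal{L}}(n)$ be the size of the largest $\mathcal{L}$-free subset of $[n]$. (i) If $q$ divides $p$ and $p+q\leq rq$, then $\mu_{\mathcal{L}}(n)=\lceil (q-1)n/q\rceil$. (ii) If $q$ divides $p$ and $p+q\geq rq$, then $\mu_{\mathcal{L}}(n)=\lceil (p+q-r)(n-a)/(p+q)\rceil + a$, where $a$ is the unique integer with $0\leq a<q$ such that $n-a$ is divisible by $q$. (iii) If $q$ does not divide $p$, $t>1$ and $$r>(r_1r_2-r_1-r_2+4)\,r_2\Big(r_1+1+\frac{r_2-1}{r_1^2+(r_1-1)(r_2-1)}\Big),$$ then $\mu_{\mathcal{L}}(n)=\lceil (t-1)n/t\rceil$.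
   Context: $[n]=\{1,\dots,n\}$. A set $A\subseteq[n]$ is $\mathcal{L}$-free if there are no $x,y,z\in A$ (not necessarily distinct) with $px+qy=rz$. (In general a set is $\mathcal{L}$-free if it contains no non-trivial solution; since $p+q-r\neq 0$ here, every solution is non-trivial.) *)

theory Defs
  imports Complex_Main
begin

definition L_free :: "nat \<Rightarrow> nat \<Rightarrow> nat \<Rightarrow> nat set \<Rightarrow> bool" where
  "L_free p q r A \<longleftrightarrow> \<not> (\<exists>x\<in>A. \<exists>y\<in>A. \<exists>z\<in>A. p * x + q * y = r * z)"
  (* For an arbitrary linear equation one only forbids non-trivial solutions.
     Trivial solutions of p x + q y = r z exist only if p + q = r, which is
     impossible for positive p, q, r with p >= q >= r. *)

definition mu :: "nat \<Rightarrow> nat \<Rightarrow> nat \<Rightarrow> nat \<Rightarrow> nat" where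
  "mu p q r n = Max {card A | A. A \<subseteq> {1..n} \<and> L_free p q r A}"

end

theory Submission
  imports Defs "HOL-Number_Theory.Cong"
begin

text \<open>
  Write \<open>p = t a\<close> and \<open>q = t b\<close> with \<open>t = gcd p q\<close>, so \<open>b = 1\<close> iff \<open>q\<close> divides \<open>p\<close>. As \<open>t\<close> is coprime
  to \<open>r\<close>, every solution has \<open>z = t w\<close> and \<open>a x + b y = r w\<close>. Given an \<open>\<L>\<close>-free set, take the largest
  \<open>w\<close> with \<open>t w\<close> in it: the multiples of \<open>t\<close> above \<open>t w\<close> are all missing, and every pair \<open>(x, y)\<close> with
  \<open>a x + b y = r w\<close> contains a missing point, which is at most \<open>t w\<close>. If \<open>b = 1\<close>, the pairs
  \<open>(x, r w - a x)\<close> with \<open>(a + 1) x \<le> r w\<close> are disjoint. Otherwise (iii) gives \<open>r \<ge> 2 a b\<close>, so there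
  are at least \<open>2 w - 1\<close> pairs, and each point lies in at most two of them.
\<close>

section \<open>Complement counts and the set of non-multiples\<close>

text \<open>\<open>M\<close> stands for the least number of missing points. Stating the value as a
  sum avoids truncated subtraction, and the upper bound also supplies the finiteness that
  \<open>Max\<close> requires.\<close>

lemma mu_add_eqI:
  assumes "A \<subseteq> {1..n}" "L_free p q r A" "n \<le> card A + M"
    and upper: "\<And>A. A \<subseteq> {1..n} \<Longrightarrow> L_free p q r A \<Longrightarrow> card A + M \<le> n"
  shows "mu p q r n + M = n"
proof -
  let ?S = "{card A | A. A \<subseteq> {1..n} \<and> L_free p q r A}"
  have "card B \<le> n" if "B \<subseteq> {1..n}" "L_free p q r B" for B
    using upper[OF that] by simp
  then have "?S \<subseteq> {..n}"
    by blast
  then have "finite ?S"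
    by (rule finite_subset) simp
  moreover have "card A + M = n"
    using assms(3) upper[OF assms(1,2)] by simp
  moreover have "card B \<le> card A" if "B \<subseteq> {1..n}" "L_free p q r B" for B
    using upper[OF that] assms(3) by simp
  ultimately have "Max ?S = card A"
    using assms(1,2) by (intro Max_eqI) blast+
  then show ?thesis
    using \<open>card A + M = n\<close> by (simp add: mu_def)
qed

lemma card_multiples_atMost:
  fixes t :: nat
  assumes "0 < t"
  shows "card {z \<in> {1..n}. t dvd z} = n div t"
proof -
  have "{z \<in> {1..n}. t dvd z} = (*) t ` {1..n div t}"
    using assms by (auto simp: image_iff less_eq_div_iff_mult_less_eq mult.commute elim!: dvdE)
  moreover have "inj_on ((*) t) {1..n div t}"
    using assms by (simp add: inj_on_def)
  ultimately show ?thesis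
    by (simp add: card_image)
qed

text \<open>The left side of any solution is divisible by \<open>t\<close>, hence so is
  \<open>z\<close>; dropping the multiples of \<open>t\<close> leaves no candidate for
  \<open>z\<close>. This is the extremal set for (i) and (iii).\<close>

lemma L_free_non_multiples:
  assumes "t dvd p" "t dvd q" "coprime t r"
  shows "L_free p q r {z \<in> {1..n}. \<not> t dvd z}"
  unfolding L_free_def
proof clarsimp
  fix x y z assume "p * x + q * y = r * z" "\<not> t dvd z"
  moreover have "t dvd p * x + q * y"
    using assms by simp
  ultimately show False
    using assms(3) by (simp add: coprime_dvd_mult_right_iff)
qed

lemma card_non_multiples:
  fixes t :: nat
  assumes "0 < t"
  shows "card {z \<in> {1..n}. \<not> t dvd z} + n div t = n"
proof -
  have "{z \<in> {1..n}. \<not> t dvd z} = {1..n} - {z \<in> {1..n}. t dvd z}"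
    by auto
  also have "card \<dots> = n - card {z \<in> {1..n}. t dvd z}"
    by (subst card_Diff_subset) auto
  also have "\<dots> = n - n div t"
    by (simp only: card_multiples_atMost[OF assms])
  finally show ?thesis
    by simp
qed

section \<open>The common upper bound\<close>

text \<open>Maximality of \<open>w\<close> accounts for the \<open>n div t - w\<close> multiples of
  \<open>t\<close> above \<open>t * w\<close>; \<open>cover\<close> is the part that differs between
  the cases, namely how many points up to \<open>t * w\<close> the reduced equation
  excludes.\<close>

lemma L_free_card_bound:
  assumes "0 < t" "p = t * a" "q = t * b" "M \<le> n div t"
    and A: "A \<subseteq> {1..n}" "L_free p q r A"
    and cover: "\<And>w. 0 < w \<Longrightarrow> w \<le> n div t \<Longrightarrow> (\<And>x y. x \<in> A \<Longrightarrow> y \<in> A \<Longrightarrow> a * x + b * y \<noteq> r * w)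
      \<Longrightarrow> M \<le> (n div t - w) + card ({1..t * w} - A)"
  shows "card A + M \<le> n"
proof -
  define W where "W = {w \<in> {1..n div t}. t * w \<in> A}"
  \<comment> \<open>The default 0 covers a set without multiples of \<open>t\<close>: then all
    \<open>n div t\<close> of them are missing, and \<open>M \<le> n div t\<close> suffices.\<close>
  define w where "w = Max (insert 0 W)"
  have finW: "finite W"
    by (simp add: W_def)
  have w_in: "w \<in> insert 0 W"
    unfolding w_def using finW by (intro Max_in) auto
  have w_le: "w \<le> n div t"
    using w_in by (auto simp: W_def)
  then have tw_le: "t * w \<le> n"
    using \<open>0 < t\<close> by (simp add: less_eq_div_iff_mult_less_eq mult.commute)
  have above: "t * v \<notin> A" if "w < v" "v \<le> n div t" for v
  proof
    assume "t * v \<in> A"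
    then have "v \<in> insert 0 W"
      using that by (auto simp: W_def)
    then have "v \<le> w"
      unfolding w_def using finW by (intro Max_ge) auto
    then show False
      using that by simp
  qed
  have "M \<le> (n div t - w) + card ({1..t * w} - A)"
  proof (cases "w = 0")
    case True
    then show ?thesis using \<open>M \<le> n div t\<close> by simp
  next
    case False
    then have "t * w \<in> A"
      using w_in by (auto simp: W_def)
    have "a * x + b * y \<noteq> r * w" if "x \<in> A" "y \<in> A" for x y
    proof
      \<comment> \<open>Multiplying by \<open>t\<close> gives a solution of the original equation
        with \<open>z = t * w\<close>, a member of \<open>A\<close>.\<close>
      assume "a * x + b * y = r * w"
      moreover have "p * x + q * y = t * (a * x + b * y)"
        using assms(2,3) by (simp add: distrib_left)
      ultimately have "p * x + q * y = r * (t * w)"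
        by simp
      then show False
        using A(2) that \<open>t * w \<in> A\<close> by (auto simp: L_free_def)
    qed
    then show ?thesis
      using cover False w_le by blast
  qed
  also have "\<dots> = card ((*) t ` {w<..n div t} \<union> ({1..t * w} - A))"
  proof -
    have "card ((*) t ` {w<..n div t}) = n div t - w"
      using \<open>0 < t\<close> by (subst card_image) (auto simp: inj_on_def)
    moreover have "(*) t ` {w<..n div t} \<inter> ({1..t * w} - A) = {}"
      using \<open>0 < t\<close> by auto
    ultimately show ?thesis
      by (simp add: card_Un_disjoint)
  qed
  also have "\<dots> \<le> card ({1..n} - A)"
  proof (rule card_mono)
    have "(*) t ` {w<..n div t} \<subseteq> {1..n} - A"
      using above \<open>0 < t\<close> by (auto simp: less_eq_div_iff_mult_less_eq mult.commute)
    then show "(*) t ` {w<..n div t} \<union> ({1..t * w} - A) \<subseteq> {1..n} - A"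
      using tw_le by auto
  qed simp
  also have "\<dots> = n - card A"
    using A(1) by (simp add: card_Diff_subset finite_subset)
  finally have "M \<le> n - card A" .
  moreover have "card A \<le> n"
    using A(1) card_mono[of "{1..n}" A] by simp
  ultimately show ?thesis
    by simp
qed

section \<open>Missing points forced by the reduced equation\<close>

text \<open>For \<open>x \<le> s\<close> the partner \<open>r * w - a * x\<close> is at least
  \<open>s\<close>, so the pairs for \<open>x = 1, ..., s\<close> are disjoint, and each has a point
  outside \<open>B\<close>.\<close>

lemma card_missing_disjoint_pairs:
  fixes a r w s N :: nat
  assumes "0 < a" "(a + 1) * s \<le> r * w" "r * w \<le> N"
    and free: "\<And>x y. x \<in> B \<Longrightarrow> y \<in> B \<Longrightarrow> a * x + y \<noteq> r * w"
  shows "s \<le> card ({1..N} - B)"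
proof -
  \<comment> \<open>Selects a missing point of the pair of \<open>x\<close>: if \<open>x\<close> is
    present, \<open>free\<close> excludes its partner.\<close>
  define h where "h x = (if x \<in> B then r * w - a * x else x)" for x
  \<comment> \<open>The last clause settles the only possible overlap: a partner equal to some
    \<open>x \<le> s\<close> must be \<open>s\<close>, and then it belongs to the pair of
    \<open>s\<close> itself.\<close>
  have partner: "a * x + (r * w - a * x) = r * w \<and> s \<le> r * w - a * x
      \<and> (r * w - a * x = s \<longrightarrow> x = s)" if "x \<le> s" for x
  proof -
    have "a * x \<le> a * s"
      using that by simp
    then have "a * x + s \<le> r * w"
      using assms(2) unfolding distrib_right mult_1 by linarith
    moreover have "x = s" if "r * w - a * x = s"
    proof -
      have "a * s \<le> a * x"
        using assms(2) that \<open>a * x + s \<le> r * w\<close>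
        unfolding distrib_right mult_1 by linarith
      then show ?thesis
        using \<open>0 < a\<close> \<open>x \<le> s\<close> by simp
    qed
    ultimately show ?thesis
      by linarith
  qed
  have "inj_on h {1..s}"
  proof (rule inj_onI)
    fix x y assume xy: "x \<in> {1..s}" "y \<in> {1..s}" "h x = h y"
    have "a * x = a * y" if "r * w - a * x = r * w - a * y"
      using partner[of x] partner[of y] xy(1,2) that by (metis add_right_cancel atLeastAtMost_iff)
    then show "x = y"
      using xy partner[of x] partner[of y] \<open>0 < a\<close> by (auto simp: h_def split: if_splits)
  qed
  moreover have "h ` {1..s} \<subseteq> {1..N} - B"
  proof
    fix u assume "u \<in> h ` {1..s}"
    then obtain x where x: "1 \<le> x" "x \<le> s" "u = h x"
      by auto
    have "s \<le> (a + 1) * s"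
      by simp
    then have "x \<le> N"
      using assms(2,3) x by linarith
    then show "u \<in> {1..N} - B"
      using partner[OF x(2)] free[of x "r * w - a * x"] x assms(3) by (auto simp: h_def)
  qed
  ultimately show ?thesis
    using card_inj_on_le[of h "{1..s}" "{1..N} - B"] by simp
qed

text \<open>By coprimality the first coordinates of solutions form a progression of step
  \<open>b\<close>, and \<open>2 * a * b \<le> r\<close> makes room for \<open>2 * w - 1\<close>
  positive solutions. A point occurs at most once as a first and once as a second coordinate. The
  bounds \<open>b \<le> a\<close> and \<open>r * w \<le> b * N\<close> keep all coordinates up to
  \<open>N\<close>.\<close>

lemma card_missing_coprime:
  fixes a b r w N :: nat
  assumes "coprime a b" "0 < b" "b \<le> a" "2 * a * b \<le> r" "r * w \<le> b * N" "0 < w"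
    and free: "\<And>x y. x \<in> B \<Longrightarrow> y \<in> B \<Longrightarrow> a * x + b * y \<noteq> r * w"
  shows "w \<le> card ({1..N} - B)"
proof -
  obtain x0 where x0: "1 \<le> x0" "x0 \<le> b" "[a * x0 = r * w] (mod b)"
  proof -
    obtain u where "[a * u = Suc 0] (mod b)"
      using cong_solve_coprime_nat[OF assms(1)] by blast
    then have "[a * u * (r * w) = Suc 0 * (r * w)] (mod b)"
      by (rule cong_scalar_right)
    moreover define x' where "x' = u * (r * w)"
    ultimately have x': "[a * x' = r * w] (mod b)"
      by (simp add: mult.assoc)
    \<comment> \<open>The residue is represented in \<open>{1..b}\<close> rather than from 0, as
      coordinates must be positive.\<close>
    let ?x = "if x' mod b = 0 then b else x' mod b"
    have "[?x = x'] (mod b)"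
      by (auto simp: cong_def)
    then have "[a * ?x = r * w] (mod b)"
      using x' by (meson cong_scalar_left cong_trans)
    moreover have "1 \<le> ?x" "?x \<le> b"
      using \<open>0 < b\<close> by (auto simp: Suc_le_eq less_imp_le)
    ultimately show thesis
      using that by blast
  qed
  define X where "X i = x0 + b * i" for i
  define Y where "Y i = (r * w - a * X i) div b" for i
  \<comment> \<open>For these \<open>i\<close>, \<open>X i \<le> b * (i + 1) < 2 * b * w\<close>, so
    \<open>a * X i < r * w\<close> and \<open>Y i\<close> is positive; one more index could give
    \<open>Y i = 0\<close>.\<close>
  define I where "I = {..<2 * w - 1}"
  have sol: "a * X i + b * Y i = r * w \<and> 0 < Y i" if "i \<in> I" for i
  proof -
    have "X i \<le> b * (i + 1)"
      using x0 by (simp add: X_def)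
    also have "\<dots> < b * (2 * w)"
      using that \<open>0 < b\<close> by (intro mult_less_mono2) (auto simp: I_def)
    finally have "a * X i < a * (b * (2 * w))"
      using assms by simp
    also have "\<dots> = 2 * a * b * w"
      by simp
    also have "\<dots> \<le> r * w"
      using assms(4) by (rule mult_le_mono1)
    finally have less: "a * X i < r * w" .
    have "a * X i = a * x0 + b * (a * i)"
      by (simp add: X_def distrib_left)
    then have "[a * X i = a * x0] (mod b)"
      by (simp only: cong_def mod_mult_self2)
    then have "[r * w = a * X i] (mod b)"
      using x0(3) by (meson cong_sym cong_trans)
    then have "b dvd r * w - a * X i"
      using less by (simp add: cong_altdef_nat)
    then have "b * Y i = r * w - a * X i"
      by (simp add: Y_def)
    then show ?thesis
      using less by (cases "Y i = 0") auto
  qed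
  have X_mem: "X i \<in> {1..N}" if "i \<in> I" for i
  proof -
    have "b * X i \<le> a * X i"
      using \<open>b \<le> a\<close> by simp
    then have "b * X i \<le> b * N"
      using sol[OF that] assms(5) by linarith
    then show ?thesis
      using x0 \<open>0 < b\<close> by (simp add: X_def)
  qed
  have Y_mem: "Y i \<in> {1..N}" if "i \<in> I" for i
  proof -
    have "b * Y i \<le> b * N"
      using sol[OF that] assms(5) by linarith
    then show ?thesis
      using sol[OF that] \<open>0 < b\<close> by simp
  qed
  have inj_X: "inj_on X I"
    using \<open>0 < b\<close> by (simp add: X_def inj_on_def)
  have inj_Y: "inj_on Y I"
  proof (rule inj_onI)
    fix i j assume "i \<in> I" "j \<in> I" "Y i = Y j"
    then have "a * X i = a * X j"
      using sol[of i] sol[of j] by (metis add_right_cancel)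
    then have "X i = X j"
      using assms(2,3) by simp
    then show "i = j"
      using inj_X \<open>i \<in> I\<close> \<open>j \<in> I\<close> by (simp add: inj_on_eq_iff)
  qed
  let ?IX = "{i \<in> I. X i \<notin> B}" and ?IY = "{i \<in> I. Y i \<notin> B}"
  have "I = ?IX \<union> ?IY"
    using sol free by blast
  then have "card I \<le> card ?IX + card ?IY"
    using card_Un_le[of ?IX ?IY] by (simp only:)
  then have "2 * w - 1 \<le> card ?IX + card ?IY"
    by (simp add: I_def)
  also have "card ?IX \<le> card ({1..N} - B)"
    using X_mem by (intro card_inj_on_le[of X]) (auto intro: inj_on_subset[OF inj_X])
  also have "card ?IY \<le> card ({1..N} - B)"
    using Y_mem by (intro card_inj_on_le[of Y]) (auto intro: inj_on_subset[OF inj_Y])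
  \<comment> \<open>Since \<open>2 * w - 1\<close> is odd, being at most twice an integer already
    makes that integer at least \<open>w\<close>.\<close>
  finally show ?thesis
    by linarith
qed

section \<open>Values of \<open>mu\<close> in the three cases\<close>

text \<open>As \<open>m + 1 \<le> r\<close>, there are \<open>w\<close> disjoint pairs up to
  \<open>q * w\<close>, so as many points are missing there as there are multiples of
  \<open>q\<close>.\<close>

lemma mu_dvd_small:
  assumes "0 < q" "0 < m" "r \<le> q" "coprime q r" "m + 1 \<le> r"
  shows "mu (q * m) q r n + n div q = n"
proof (rule mu_add_eqI)
  show "L_free (q * m) q r {z \<in> {1..n}. \<not> q dvd z}"
    using assms by (intro L_free_non_multiples) auto
  show "n \<le> card {z \<in> {1..n}. \<not> q dvd z} + n div q"
    using card_non_multiples[OF \<open>0 < q\<close>, of n] by simp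
  fix A assume A: "A \<subseteq> {1..n}" "L_free (q * m) q r A"
  show "card A + n div q \<le> n"
  proof (rule L_free_card_bound[where t = q and a = m and b = 1])
    fix w
    assume "0 < w" "w \<le> n div q" and free: "\<And>x y. x \<in> A \<Longrightarrow> y \<in> A \<Longrightarrow> m * x + 1 * y \<noteq> r * w"
    have "(m + 1) * w \<le> r * w"
      using assms(5) by (rule mult_le_mono1)
    then have "w \<le> card ({1..q * w} - A)"
      using assms free by (intro card_missing_disjoint_pairs[of m _ r w]) auto
    then show "n div q \<le> (n div q - w) + card ({1..q * w} - A)"
      by linarith
  qed (use assms A in auto)
qed auto

text \<open>The extremal set is an interval. With \<open>k = n div q\<close> and
  \<open>M = r * k div (m + 1)\<close>, points \<open>x, y > M\<close> give
  \<open>m * x + y \<ge> (m + 1) * (M + 1) > r * k\<close>, whereas a solution has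
  \<open>z = q * w\<close> with \<open>w \<le> k\<close> and
  \<open>m * x + y = r * w\<close>.\<close>

lemma mu_dvd_large:
  assumes "0 < q" "0 < m" "r \<le> q" "coprime q r" "r \<le> m + 1"
  shows "mu (q * m) q r n + r * (n div q) div (m + 1) = n"
proof (rule mu_add_eqI)
  define k where "k = n div q"
  define M where "M = r * k div (m + 1)"
  have le: "M \<le> k"
  proof -
    have "r * k \<le> (m + 1) * k"
      using assms by (intro mult_le_mono1) 
    then have "M \<le> (m + 1) * k div (m + 1)"
      unfolding M_def by (rule div_le_mono)
    then show ?thesis
      by (simp only: nonzero_mult_div_cancel_left)
  qed
  show "L_free (q * m) q r {r * (n div q) div (m + 1)<..n}"
    unfolding L_free_def k_def[symmetric] M_def[symmetric]
  proof clarsimp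
    fix x y z assume xyz: "M < x" "M < y" "z \<le> n" "q * m * x + q * y = r * z"
    then have "q * (m * x + y) = r * z"
      by (simp add: distrib_left)
    then have "q dvd z"
      using assms(4) by (metis coprime_dvd_mult_right_iff dvd_triv_left)
    then obtain w where w: "z = q * w" ..
    have "w \<le> k"
      using xyz(3) w \<open>0 < q\<close> by (simp add: k_def less_eq_div_iff_mult_less_eq mult.commute)
    have "r * z = q * (r * w)"
      by (simp add: w)
    then have "q * (m * x + y) = q * (r * w)"
      using \<open>q * (m * x + y) = r * z\<close> by (simp only:)
    then have "m * x + y = r * w"
      using \<open>0 < q\<close> by auto
    also have "\<dots> \<le> r * k"
      using \<open>w \<le> k\<close> by simp
    also have "\<dots> < (M + 1) * (m + 1)"
      unfolding M_def using dividend_less_div_times[of "m + 1" "r * k"] by simp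
    also have "\<dots> = m * (M + 1) + (M + 1)"
      by simp
    also have "\<dots> \<le> m * x + y"
      using xyz by (intro add_mono mult_le_mono2) auto
    finally show False
      by simp
  qed
  show "n \<le> card {r * (n div q) div (m + 1)<..n} + r * (n div q) div (m + 1)"
    by simp
  fix A assume A: "A \<subseteq> {1..n}" "L_free (q * m) q r A"
  show "card A + r * (n div q) div (m + 1) \<le> n"
    unfolding k_def[symmetric] M_def[symmetric]
  proof (rule L_free_card_bound[where t = q and a = m and b = 1])
    fix w
    assume "0 < w" "w \<le> n div q" and free: "\<And>x y. x \<in> A \<Longrightarrow> y \<in> A \<Longrightarrow> m * x + 1 * y \<noteq> r * w"
    then have "w \<le> k"
      by (simp add: k_def)
    have "(m + 1) * (r * w div (m + 1)) \<le> r * w"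
      by (rule times_div_less_eq_dividend)
    then have "r * w div (m + 1) \<le> card ({1..q * w} - A)"
      using assms free by (intro card_missing_disjoint_pairs[of m _ r w]) auto
    \<comment> \<open>Because \<open>r \<le> m + 1\<close>, each step from \<open>w\<close> up to
      \<open>k\<close> raises the quotient by at most one, which the missing multiples above
      \<open>q * w\<close> pay for.\<close>
    moreover have "M \<le> (k - w) + r * w div (m + 1)"
    proof -
      have "r * k = r * (k - w) + r * w"
        using \<open>w \<le> k\<close> by (simp flip: distrib_left)
      also have "\<dots> \<le> (m + 1) * (k - w) + r * w"
        using assms(5) by (intro add_right_mono mult_le_mono1)
      finally have "M \<le> ((m + 1) * (k - w) + r * w) div (m + 1)"
        unfolding M_def by (rule div_le_mono)
      also have "\<dots> = (k - w) + r * w div (m + 1)"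
        by (rule div_mult_self4) simp
      finally show ?thesis .
    qed
    ultimately show "M \<le> (n div q - w) + card ({1..q * w} - A)"
      by (simp add: k_def)
  qed (use assms A le k_def in auto)
qed auto

lemma mu_not_dvd:
  assumes "0 < t" "coprime a b" "0 < b" "b \<le> a" "r \<le> t * b" "coprime t r" "2 * a * b \<le> r"
  shows "mu (t * a) (t * b) r n + n div t = n"
proof (rule mu_add_eqI)
  show "L_free (t * a) (t * b) r {z \<in> {1..n}. \<not> t dvd z}"
    using assms by (intro L_free_non_multiples) auto
  show "n \<le> card {z \<in> {1..n}. \<not> t dvd z} + n div t"
    using card_non_multiples[OF \<open>0 < t\<close>, of n] by simp
  fix A assume A: "A \<subseteq> {1..n}" "L_free (t * a) (t * b) r A"
  show "card A + n div t \<le> n"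
  proof (rule L_free_card_bound[where t = t and a = a and b = b])
    fix w
    assume w: "0 < w" "w \<le> n div t" and free: "\<And>x y. x \<in> A \<Longrightarrow> y \<in> A \<Longrightarrow> a * x + b * y \<noteq> r * w"
    \<comment> \<open>This is where \<open>r \<le> q\<close> enters: it confines the solutions to
      points up to \<open>t * w\<close>.\<close>
    have "r * w \<le> b * (t * w)"
      using mult_le_mono1[OF assms(5), of w] by (simp add: ac_simps)
    then have "w \<le> card ({1..t * w} - A)"
      using assms w free by (intro card_missing_coprime[of a b r w]) auto
    then show "n div t \<le> (n div t - w) + card ({1..t * w} - A)"
      by linarith
  qed (use assms A in auto)
qed auto

section \<open>Ceilings and the numerical bound on \<open>r\<close>\<close>

text \<open>The ceiling of \<open>n - x\<close> is \<open>n\<close> minus the floor of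
  \<open>x\<close>, and the floor of the fraction is \<open>d div e\<close>.\<close>

lemma ceiling_fraction_complement:
  fixes n d e :: nat
  assumes "N + d div e = n"
  shows "int N = \<lceil>real n - real d / real e\<rceil>"
proof -
  have "\<lceil>real n - real d / real e\<rceil> = \<lceil>real_of_int (int n) + - (real d / real e)\<rceil>"
    by simp
  also have "\<dots> = int n + \<lceil>- (real d / real e)\<rceil>"
    by (subst add.commute, subst ceiling_add_of_int) simp
  also have "\<dots> = int n - int (d div e)"
    by (simp add: ceiling_minus floor_divide_of_nat_eq)
  finally show ?thesis
    using assms by simp
qed

text \<open>The first factor equals \<open>(a - 1) * (b - 1) + 3\<close>, hence exceeds 2; the last
  is at least \<open>a\<close>, its fraction being nonnegative.\<close>

lemma two_mult_le_of_bound: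
  fixes r a b :: nat
  assumes "2 \<le> b" "b \<le> a"
    and r: "real r > (real a * real b - real a - real b + 4) * real b *
      (real a + 1 + (real b - 1) / ((real a)\<^sup>2 + (real a - 1) * (real b - 1)))"
  shows "2 * a * b \<le> r"
proof -
  have ab: "2 \<le> real b" "2 \<le> real a"
    using assms by simp_all
  have "0 \<le> (real a - 1) * (real b - 1)"
    using ab by simp
  then have "2 \<le> real a * real b - real a - real b + 4"
    by (simp add: algebra_simps)
  moreover have "0 \<le> (real b - 1) / ((real a)\<^sup>2 + (real a - 1) * (real b - 1))"
    using ab \<open>0 \<le> (real a - 1) * (real b - 1)\<close> by simp
  ultimately have "2 * real b * real a \<le> (real a * real b - real a - real b + 4) * real b *
      (real a + 1 + (real b - 1) / ((real a)\<^sup>2 + (real a - 1) * (real b - 1)))"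
    using ab by (intro mult_mono) auto
  then have "real (2 * a * b) \<le> real r"
    using r by (simp add: mult.commute mult.left_commute)
  then show ?thesis
    by (simp only: of_nat_le_iff)
qed

section \<open>From missing points to the three formulas\<close>

theorem theorem1p1:
  fixes p q r t r1 r2 n :: nat
  assumes "0 < p" "0 < q" "0 < r"
    and "p \<ge> q" "q \<ge> r"
    and "Gcd {p, q, r} = 1"
    and "t = gcd p q" "r1 = p div t" "r2 = q div t"
  shows
    "(q dvd p \<and> p + q \<le> r * q \<longrightarrow>
        int (mu p q r n) = \<lceil>(real q - 1) * real n / real q\<rceil>) \<and>
     (q dvd p \<and> p + q \<ge> r * q \<longrightarrow>
        (\<exists>!a::int. 0 \<le> a \<and> a < int q \<and> int q dvd int n - a) \<and>
        (\<forall>a::int. 0 \<le> a \<and> a < int q \<and> int q dvd int n - a \<longrightarrow>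
           int (mu p q r n) =
             \<lceil>(real p + real q - real r) * (real n - real_of_int a) / (real p + real q)\<rceil> + a)) \<and>
     (\<not> q dvd p \<and> t > 1 \<and>
      real r > (real r1 * real r2 - real r1 - real r2 + 4) * real r2 *
               (real r1 + 1 + (real r2 - 1) / ((real r1)\<^sup>2 + (real r1 - 1) * (real r2 - 1))) \<longrightarrow>
        int (mu p q r n) = \<lceil>(real t - 1) * real n / real t\<rceil>)"
proof (intro conjI impI)
  have gcd_r: "coprime (gcd p q) r"
    using assms(6) by (simp add: coprime_iff_gcd_eq_1 gcd.assoc)
  {
    assume h: "q dvd p \<and> p + q \<le> r * q"
    then obtain m where m: "p = q * m" by blast
    have "q * (m + 1) \<le> q * r"
      using h m by (simp add: algebra_simps)
    then have "m + 1 \<le> r"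
      using \<open>0 < q\<close> by (simp only: nat_mult_le_cancel_disj)
    then have "mu p q r n + n div q = n"
      unfolding m using assms(1,2,5) gcd_r m by (intro mu_dvd_small) auto
    then have "int (mu p q r n) = \<lceil>real n - real n / real q\<rceil>"
      by (rule ceiling_fraction_complement)
    also have "real n - real n / real q = (real q - 1) * real n / real q"
      using \<open>0 < q\<close> by (simp add: field_simps)
    finally show "int (mu p q r n) = \<lceil>(real q - 1) * real n / real q\<rceil>" .
  }
  \<comment> \<open>The conditions on \<open>a\<close> single out the remainder of \<open>n\<close>,
    so \<open>n - a\<close> is \<open>q * (n div q)\<close>.\<close>
  have uniq: "a = int (n mod q)" if "0 \<le> a \<and> a < int q \<and> int q dvd int n - a" for a
  proof -
    have "int n mod int q = a mod int q"
      using that by (intro mod_eq_dvd_iff[THEN iffD2]) simp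
    also have "\<dots> = a"
      using that by simp
    finally show ?thesis
      by (simp add: of_nat_mod)
  qed
  show "\<exists>!a::int. 0 \<le> a \<and> a < int q \<and> int q dvd int n - a"
  proof (rule ex1I[OF _ uniq])
    have "int q dvd int n - int n mod int q"
      by (rule dvd_minus_mod)
    then show "0 \<le> int (n mod q) \<and> int (n mod q) < int q \<and> int q dvd int n - int (n mod q)"
      using \<open>0 < q\<close> by (simp add: of_nat_mod)
  qed
  {
    assume h: "q dvd p \<and> r * q \<le> p + q"
    then obtain m where m: "p = q * m" by blast
    show "\<forall>a::int. 0 \<le> a \<and> a < int q \<and> int q dvd int n - a \<longrightarrow>
        int (mu p q r n) =
          \<lceil>(real p + real q - real r) * (real n - real_of_int a) / (real p + real q)\<rceil> + a"
    proof (intro allI impI)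
      fix a :: int
      assume "0 \<le> a \<and> a < int q \<and> int q dvd int n - a"
      then have a: "a = int (n mod q)"
        by (rule uniq)
      let ?k = "n div q"
      have n: "q * ?k + n mod q = n"
        by simp
      have "q * r \<le> q * (m + 1)"
        using h m by (simp add: algebra_simps)
      then have "r \<le> m + 1"
        using \<open>0 < q\<close> by (simp only: nat_mult_le_cancel_disj)
      then have "mu p q r n + r * ?k div (m + 1) = n"
        unfolding m using assms(1,2,5) gcd_r m by (intro mu_dvd_large) auto
      then have "int (mu p q r n) = \<lceil>real n - real (r * ?k) / real (m + 1)\<rceil>"
        by (rule ceiling_fraction_complement)
      \<comment> \<open>Substituting \<open>n - a = q * ?k\<close> and
        \<open>p + q = q * (m + 1)\<close> cancels \<open>q\<close>; the integer \<open>a\<close>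
        then leaves the ceiling.\<close>
      also have "real n - real (r * ?k) / real (m + 1)
          = (real p + real q - real r) * (real n - real_of_int a) / (real p + real q) + real_of_int a"
      proof -
        have na: "real n - real_of_int a = real q * real ?k"
          unfolding a using n by (metis add_diff_cancel_right' of_int_of_nat_eq of_nat_add of_nat_mult)
        have pq: "real p + real q = real q * real (m + 1)"
          using m by (simp add: algebra_simps)
        have "(real p + real q - real r) * (real n - real_of_int a) / (real p + real q)
            = real q * real ?k - real (r * ?k) / real (m + 1)"
        proof -
          have "(Q * M - R) * (Q * K) / (Q * M) = Q * K - R * K / M"
            if "Q \<noteq> 0" "M \<noteq> 0" for Q M R K :: real
            using that by (simp add: field_simps)
          then show ?thesis
            unfolding na pq of_nat_mult using \<open>0 < q\<close> by simp
        qed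
        then show ?thesis
          using na by simp
      qed
      finally show "int (mu p q r n) =
          \<lceil>(real p + real q - real r) * (real n - real_of_int a) / (real p + real q)\<rceil> + a"
        by simp
    qed
  }
  assume h: "\<not> q dvd p \<and> t > 1 \<and>
      real r > (real r1 * real r2 - real r1 - real r2 + 4) * real r2 *
               (real r1 + 1 + (real r2 - 1) / ((real r1)\<^sup>2 + (real r1 - 1) * (real r2 - 1)))"
  have t: "0 < t" "t * r1 = p" "t * r2 = q"
    using h assms(7-9) by auto
  have cop: "coprime r1 r2"
    using assms(2,7-9) by (simp add: div_gcd_coprime)
  \<comment> \<open>If \<open>r2 = 1\<close> then \<open>q = t\<close> would divide
    \<open>p\<close>; hence \<open>r2 \<ge> 2\<close>, as the numerical estimate requires.\<close>
  have "r2 \<noteq> 0" "r2 \<noteq> 1"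
    using t assms(2) h by auto
  moreover have "t * r2 \<le> t * r1"
    using t assms(4) by simp
  then have "r2 \<le> r1"
    using t(1) by simp
  ultimately have "mu (t * r1) (t * r2) r n + n div t = n"
    using t cop gcd_r h assms(5,7) by (intro mu_not_dvd two_mult_le_of_bound) auto
  then have "mu p q r n + n div t = n"
    by (simp only: t)
  then have "int (mu p q r n) = \<lceil>real n - real n / real t\<rceil>"
    by (rule ceiling_fraction_complement)
  also have "real n - real n / real t = (real t - 1) * real n / real t"
    using t(1) by (simp add: field_simps)
  finally show "int (mu p q r n) = \<lceil>(real t - 1) * real n / real t\<rceil>" .
qed

end
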